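(* Consider problem (P) and the approximate ADMM algorithm as described in the context, with fixed initial values $x^0,z^0,y^0$ and parameters $\rho>0,\sigma>0,\alpha\in(0,2)$. For any nonnegative summable error sequences $(\mu^k),(\nu^k)$, the limits $$\delta x\coloneqq\lim_{k\to\infty}(x^{k+1}-x^k),\qquad \delta y\coloneqq\lim_{k\to\infty}(y^{k+1}-y^k)$$ of the iterates of the algorithm exist and are equal to the corresponding limits for the iterates of the same algorithm run with $\mu^k=\nu^k=0$ for all $k$ (i.e. with all steps computed exactly).
   Context: Problem (P): $\min_{x\in\mathbb{R}^n,z\in\mathbb{R}^m}\ \tfrac12x^TPx+q^Tx$ s.t. $Ax=z$, $z\in\mathcal{C}$, where $P$ is symmetric positive semidefinite, $q\in\mathbb{R}^n$, $A\in\mathbb{R}^{m\times n}$, and $\mathcal{C}\subseteq\mathbb{R}^m$ is a nonempty closed convex set that is the Cartesian product of a compact convex set and a translate of a closed convex cone. Approximate ADMM algorithm: given $x^0,z^0,y^0$, $\rho>0,\sigma>0,\alpha\in(0,2)$ and nonnegative summable $(\mu^k),(\nu^k)$, for $k=0,1,\dots$: 1. choose $(\tilde x^{k+1},\tilde z^{k+1})$ within Euclidean distance $\mu^k$ of the exact solution $(\hat x,\hat z)$ of $\begin{bmatrix}P+\sigma I & \rho A^T\\ \rho A & -\rho I\end{bmatrix}\begin{bmatrix}\hat x\\ \hat z\end{bmatrix}=\begin{bmatrix}\sigma x^k+\rho A^T(z^k-y^k/\rho)-q\\ 0\end{bmatrix}$; 2. $x^{k+1}=\alpha\tilde x^{k+1}+(1-\alpha)x^k$;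 3. choose $z^{k+1}$ within Euclidean distance $\nu^k$ of $\Pi_{\mathcal{C}}(\alpha\tilde z^{k+1}+(1-\alpha)z^k+y^k/\rho)$, $\Pi_{\mathcal{C}}$ the Euclidean projection onto $\mathcal{C}$; 4. $y^{k+1}=y^k+\rho(\alpha\tilde z^{k+1}+(1-\alpha)z^k-z^{k+1})$. *)

theory Defs
  imports "HOL-Analysis.Analysis"
begin

text \<open>Coordinate restriction of a vector in R^m to an index set S (other coordinates set to 0).\<close>
definition restr :: "'m set \<Rightarrow> real^'m \<Rightarrow> real^'m" where
  "restr S z = (\<chi> i. if i \<in> S then z $ i else 0)"

text \<open>C is (up to the coordinate splitting R^m = R^S x R^(complement S)) the Cartesian product
  of a nonempty compact convex set D and a translate b + K of a nonempty closed convex cone K.\<close>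
definition product_compact_cone :: "(real^'m) set \<Rightarrow> bool" where
  "product_compact_cone C \<longleftrightarrow>
     (\<exists>S D K b.
        D \<noteq> {} \<and> compact D \<and> convex D \<and> (\<forall>d\<in>D. restr S d = d) \<and>
        K \<noteq> {} \<and> closed K \<and> convex K \<and> cone K \<and> (\<forall>v\<in>K. restr (- S) v = v) \<and>
        restr (- S) b = b \<and>
        C = {z. restr S z \<in> D \<and> restr (- S) z \<in> (\<lambda>v. b + v) ` K})"

text \<open>The approximate ADMM iteration with error sequences mu, nu.
  xt, zt are the tilde iterates (xt (Suc k), zt (Suc k) are computed in step k).\<close>
definition approx_admm ::
  "real^'n^'n \<Rightarrow> real^'n \<Rightarrow> real^'n^'m \<Rightarrow> (real^'m) set \<Rightarrow> real \<Rightarrow> real \<Rightarrow> real \<Rightarrow>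
   (nat \<Rightarrow> real) \<Rightarrow> (nat \<Rightarrow> real) \<Rightarrow>
   (nat \<Rightarrow> real^'n) \<Rightarrow> (nat \<Rightarrow> real^'m) \<Rightarrow> (nat \<Rightarrow> real^'m) \<Rightarrow>
   (nat \<Rightarrow> real^'n) \<Rightarrow> (nat \<Rightarrow> real^'m) \<Rightarrow> bool" where
  "approx_admm P q A C \<rho> \<sigma> \<alpha> \<mu> \<nu> x z y xt zt \<longleftrightarrow>
    (\<forall>k.
      (\<exists>xh zh.
         P *v xh + \<sigma> *\<^sub>R xh + \<rho> *\<^sub>R (transpose A *v zh)
           = \<sigma> *\<^sub>R x k + \<rho> *\<^sub>R (transpose A *v (z k - (1 / \<rho>) *\<^sub>R y k)) - q \<and>
         \<rho> *\<^sub>R (A *v xh) - \<rho> *\<^sub>R zh = 0 \<and>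
         sqrt ((norm (xt (Suc k) - xh))\<^sup>2 + (norm (zt (Suc k) - zh))\<^sup>2) \<le> \<mu> k) \<and>
      x (Suc k) = \<alpha> *\<^sub>R xt (Suc k) + (1 - \<alpha>) *\<^sub>R x k \<and>
      dist (z (Suc k))
        (closest_point C (\<alpha> *\<^sub>R zt (Suc k) + (1 - \<alpha>) *\<^sub>R z k + (1 / \<rho>) *\<^sub>R y k)) \<le> \<nu> k \<and>
      y (Suc k) = y k + \<rho> *\<^sub>R (\<alpha> *\<^sub>R zt (Suc k) + (1 - \<alpha>) *\<^sub>R z k - z (Suc k)))"

end

theory Submission
  imports Defs
begin

(* Scaling x by sqrt sigma and the scaled dual variable z + y / rho by sqrt rho turns ADMM
   into the relaxed Douglas-Rachford iteration s |-> T s, T = (1 - alpha/2) I + (alpha/2) R1 R2,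
   where R1, R2 are the reflections of two firmly nonexpansive resolvents; such a T is averaged.
   For an averaged operator the displacements s - T s along an exact orbit converge (Pazy): their
   norms decrease to the distance of 0 from the closure of range (I - T), which is convex, so the
   parallelogram law makes them Cauchy. The limit does not depend on the orbit. Summable errors
   perturb the orbit by a summable sequence, and the averagedness inequality makes the squared
   gaps between perturbed and exact displacements summable. Hence both runs have the same limit
   of s(k+1) - s(k), from which the limits of the x- and y-increments are read off. *)

lemma power2_norm_convex_combination:
  fixes p q :: "'a::real_inner"
  shows "(norm ((1 - l) *\<^sub>R p + l *\<^sub>R q))\<^sup>2
    = (1 - l) * (norm p)\<^sup>2 + l * (norm q)\<^sup>2 - l * (1 - l) * (norm (p - q))\<^sup>2"
  by (simp add: power2_norm_eq_inner inner_simps algebra_simps)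

lemma power2_norm_Pair: "(norm (a, b))\<^sup>2 = (norm a)\<^sup>2 + (norm b)\<^sup>2"
  unfolding norm_Pair by simp

lemma norm_diff_less_if_midpoint_norm_ge:
  fixes a b :: "'a::real_inner"
  assumes "0 \<le> L" "0 < \<epsilon>" "L \<le> norm ((1/2) *\<^sub>R (a + b))"
    and "(norm a)\<^sup>2 < L\<^sup>2 + \<epsilon>\<^sup>2 / 4" "(norm b)\<^sup>2 < L\<^sup>2 + \<epsilon>\<^sup>2 / 4"
  shows "norm (a - b) < \<epsilon>"
proof -
  have "(norm (a - b))\<^sup>2 = 2 * (norm a)\<^sup>2 + 2 * (norm b)\<^sup>2 - 4 * (norm ((1/2) *\<^sub>R (a + b)))\<^sup>2"
    by (simp add: power2_norm_eq_inner inner_simps algebra_simps inner_commute)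
  moreover have "L\<^sup>2 \<le> (norm ((1/2) *\<^sub>R (a + b)))\<^sup>2"
    using assms(1,3) by (simp add: power_mono)
  ultimately have "(norm (a - b))\<^sup>2 < \<epsilon>\<^sup>2" using assms(4,5) by linarith
  then show ?thesis by (rule power2_less_imp_less) (use assms(2) in simp)
qed

lemma le_add_sqrt_if_square_le:
  fixes b c r :: real
  assumes "0 \<le> b" "0 \<le> c" "r\<^sup>2 \<le> b * r + c"
  shows "r \<le> b + sqrt c"
proof (rule ccontr)
  assume "\<not> ?thesis"
  then have "sqrt c < r - b" by simp
  then have "c < (r - b)\<^sup>2"
    using assms(2) power_strict_mono[of "sqrt c" "r - b" 2] by simp
  moreover have "(r - b)\<^sup>2 \<le> c - b * (r - b)"
    using assms(3) by (simp add: power2_eq_square algebra_simps)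
  moreover have "0 \<le> b * (r - b)"
    using \<open>sqrt c < r - b\<close> assms real_sqrt_ge_zero[of c] by (intro mult_nonneg_nonneg) linarith+
  ultimately show False by simp
qed

definition firmly_nonexpansive :: "('a::real_inner \<Rightarrow> 'a) \<Rightarrow> bool" where
  "firmly_nonexpansive J \<longleftrightarrow> (\<forall>x y. (norm (J x - J y))\<^sup>2 \<le> inner (J x - J y) (x - y))"

definition reflection :: "('a::real_vector \<Rightarrow> 'a) \<Rightarrow> 'a \<Rightarrow> 'a" where
  "reflection J x = 2 *\<^sub>R J x - x"

lemma firmly_nonexpansive_reflection:
  assumes "firmly_nonexpansive J"
  shows "norm (reflection J x - reflection J y) \<le> norm (x - y)"
proof -
  have firm: "(norm (J x - J y))\<^sup>2 \<le> inner (J x - J y) (x - y)"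
    using assms unfolding firmly_nonexpansive_def by blast
  have "(norm (reflection J x - reflection J y))\<^sup>2
      = 4 * (norm (J x - J y))\<^sup>2 - 4 * inner (J x - J y) (x - y) + (norm (x - y))\<^sup>2"
    unfolding reflection_def
    by (simp add: power2_norm_eq_inner inner_simps algebra_simps inner_commute)
  also have "\<dots> \<le> (norm (x - y))\<^sup>2"
    using firm by linarith
  finally show ?thesis by (rule power2_le_imp_le) simp
qed

lemma firmly_nonexpansive_closest_point:
  assumes "convex S" "closed S" "S \<noteq> {}"
  shows "firmly_nonexpansive (closest_point S)"
  unfolding firmly_nonexpansive_def
proof (intro allI)
  fix u w
  have "inner (u - closest_point S u) (closest_point S w - closest_point S u) \<le> 0"
    and "inner (w - closest_point S w) (closest_point S u - closest_point S w) \<le> 0"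
    by (simp_all add: assms closest_point_dot closest_point_in_set)
  then show "(norm (closest_point S u - closest_point S w))\<^sup>2
      \<le> inner (closest_point S u - closest_point S w) (u - w)"
    by (simp add: power2_norm_eq_inner inner_simps inner_commute algebra_simps)
qed

text \<open>With \<open>c = (1 - l) / l\<close> this is the usual notion of an \<open>l\<close>-averaged operator.\<close>
locale averaged_operator =
  fixes T :: "'a::{real_inner, complete_space} \<Rightarrow> 'a" and c :: real
  assumes c_pos: "c > 0"
    and averaged: "\<And>x y. (norm (T x - T y))\<^sup>2
      \<le> (norm (x - y))\<^sup>2 - c * (norm ((x - T x) - (y - T y)))\<^sup>2"

lemma averaged_operator_relaxed_reflections:
  fixes J1 J2 :: "'a::{real_inner, complete_space} \<Rightarrow> 'a"
  assumes "firmly_nonexpansive J1" "firmly_nonexpansive J2" "0 < l" "l < 1"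
  shows "averaged_operator (\<lambda>x. (1 - l) *\<^sub>R x + l *\<^sub>R reflection J1 (reflection J2 x)) ((1 - l) / l)"
proof
  show "0 < (1 - l) / l" using assms by simp
next
  fix x y
  define N where "N x = reflection J1 (reflection J2 x)" for x
  define T where "T x = (1 - l) *\<^sub>R x + l *\<^sub>R N x" for x
  have N: "(norm (N x - N y))\<^sup>2 \<le> (norm (x - y))\<^sup>2"
    using firmly_nonexpansive_reflection[OF assms(1), of "reflection J2 x" "reflection J2 y"]
      firmly_nonexpansive_reflection[OF assms(2), of x y]
    unfolding N_def by (intro power_mono) auto
  have "T x - T y = (1 - l) *\<^sub>R (x - y) + l *\<^sub>R (N x - N y)"
    unfolding T_def by (simp add: algebra_simps)
  then have "(norm (T x - T y))\<^sup>2 = (1 - l) * (norm (x - y))\<^sup>2 + l * (norm (N x - N y))\<^sup>2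
      - l * (1 - l) * (norm ((x - y) - (N x - N y)))\<^sup>2"
    by (simp add: power2_norm_convex_combination)
  moreover have "(1 - l) / l * (norm ((x - T x) - (y - T y)))\<^sup>2
      = l * (1 - l) * (norm ((x - y) - (N x - N y)))\<^sup>2"
  proof -
    have "(x - T x) - (y - T y) = l *\<^sub>R ((x - y) - (N x - N y))"
      unfolding T_def by (simp add: algebra_simps)
    then show ?thesis using assms by (simp add: power_mult_distrib power2_eq_square)
  qed
  moreover have "l * (norm (N x - N y))\<^sup>2 \<le> l * (norm (x - y))\<^sup>2"
    using N assms by (simp add: mult_left_mono)
  ultimately show "(norm (T x - T y))\<^sup>2
      \<le> (norm (x - y))\<^sup>2 - (1 - l) / l * (norm ((x - T x) - (y - T y)))\<^sup>2"
    unfolding T_def N_def by (simp add: algebra_simps)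
qed

context averaged_operator
begin

definition displacement :: "'a \<Rightarrow> 'a" where
  "displacement x = x - T x"

lemma nonexpansive: "norm (T x - T y) \<le> norm (x - y)"
proof -
  have "(norm (T x - T y))\<^sup>2 \<le> (norm (x - y))\<^sup>2"
    using averaged[of x y] c_pos by (smt (verit) mult_nonneg_nonneg zero_le_power2)
  then show ?thesis by (rule power2_le_imp_le) simp
qed

lemma displacement_monotone: "0 \<le> inner (displacement x - displacement y) (x - y)"
proof -
  let ?d = "displacement x - displacement y"
  have Td: "T x - T y = (x - y) - ?d" unfolding displacement_def by (simp add: algebra_simps)
  have "(norm (T x - T y))\<^sup>2 = (norm (x - y))\<^sup>2 - 2 * inner ?d (x - y) + (norm ?d)\<^sup>2"
    unfolding Td by (simp add: power2_norm_eq_inner inner_simps algebra_simps inner_commute)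
  with averaged[of x y] have "(1 + c) * (norm ?d)\<^sup>2 \<le> 2 * inner ?d (x - y)"
    unfolding displacement_def by (simp add: algebra_simps)
  moreover have "0 \<le> (1 + c) * (norm ?d)\<^sup>2" using c_pos by simp
  ultimately show ?thesis by linarith
qed

lemma norm_displacement_T_le: "norm (displacement (T x)) \<le> norm (displacement x)"
  using nonexpansive[of x "T x"] unfolding displacement_def by (simp add: norm_minus_commute)

lemma norm_displacement_funpow_le: "norm (displacement ((T ^^ k) x)) \<le> norm (displacement x)"
  by (induction k) (auto intro: order_trans[OF norm_displacement_T_le])

lemma averaged_step_estimate:
  "c * (norm (displacement s - displacement u))\<^sup>2
    \<le> (norm (s - u))\<^sup>2 - (norm (T s + e - T u))\<^sup>2 + norm e * (2 * norm (s - u) + norm e)"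
proof -
  define t where "t = norm (T s - T u)"
  have "norm (T s + e - T u) \<le> t + norm e"
    unfolding t_def by (metis add.commute add_diff_eq diff_add_eq norm_triangle_ineq)
  then have "(norm (T s + e - T u))\<^sup>2 \<le> (t + norm e)\<^sup>2" by (simp add: power_mono)
  also have "\<dots> = t\<^sup>2 + norm e * (2 * t + norm e)" by (simp add: power2_eq_square algebra_simps)
  also have "\<dots> \<le> t\<^sup>2 + norm e * (2 * norm (s - u) + norm e)"
    using nonexpansive[of s u] unfolding t_def by (intro add_left_mono mult_left_mono) auto
  finally show ?thesis
    using averaged[of s u] unfolding t_def displacement_def by linarith
qed

lemma displacement_perturbed_orbit_tendsto:
  assumes s: "\<And>k. s (Suc k) = T (s k) + e k" and e: "summable (\<lambda>k. norm (e k))"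
    and u: "\<And>k. u (Suc k) = T (u k)"
  shows "(\<lambda>k. displacement (s k) - displacement (u k)) \<longlonglongrightarrow> 0"
proof -
  define E where "E = (\<Sum>k. norm (e k))"
  define a where "a k = norm (s k - u k)" for k
  define M where "M = a 0 + E"
  have partial_le_E: "(\<Sum>i<n. norm (e i)) \<le> E" for n
    unfolding E_def by (rule sum_le_suminf[OF e]) auto
  have a_le: "a k \<le> a 0 + (\<Sum>i<k. norm (e i))" for k
  proof (induction k)
    case (Suc k)
    have "a (Suc k) \<le> norm (T (s k) - T (u k)) + norm (e k)"
      unfolding a_def s u by (metis add.commute add_diff_eq norm_triangle_ineq diff_add_eq)
    then show ?case using Suc nonexpansive[of "s k" "u k"] unfolding a_def by simp
  qed simp
  have a_le_M: "a k \<le> M" for k using a_le[of k] partial_le_E[of k] unfolding M_def by linarith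
  have e_le_E: "norm (e k) \<le> E" for k
    using sum_le_suminf[OF e, of "{k}"] unfolding E_def by simp
  have step: "c * (norm (displacement (s k) - displacement (u k)))\<^sup>2
      \<le> (a k)\<^sup>2 - (a (Suc k))\<^sup>2 + (2 * M + E) * norm (e k)" for k
  proof -
    have "norm (e k) * (2 * a k + norm (e k)) \<le> (2 * M + E) * norm (e k)"
      using a_le_M[of k] e_le_E[of k] by (simp add: mult.commute mult_left_mono)
    then show ?thesis
      using averaged_step_estimate[of "s k" "u k" "e k"] unfolding a_def s u by linarith
  qed
  have "(\<Sum>k<n. c * (norm (displacement (s k) - displacement (u k)))\<^sup>2)
      \<le> (a 0)\<^sup>2 - (a n)\<^sup>2 + (2 * M + E) * (\<Sum>k<n. norm (e k))" for n
  proof (induction n)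
    case (Suc n)
    then show ?case using step[of n] by (simp add: algebra_simps)
  qed simp
  also have "\<dots> n \<le> (a 0)\<^sup>2 + (2 * M + E) * E" for n
  proof -
    have "0 \<le> M" "0 \<le> E"
      using a_le_M[of 0] partial_le_E[of 0] unfolding a_def by (auto intro: order_trans[OF norm_ge_zero])
    then show ?thesis using partial_le_E[of n] by (smt (verit) mult_left_mono zero_le_power2)
  qed
  finally have "summable (\<lambda>k. c * (norm (displacement (s k) - displacement (u k)))\<^sup>2)"
    by (intro summableI_nonneg_bounded) (use c_pos in auto)
  then have "(\<lambda>k. c * (norm (displacement (s k) - displacement (u k)))\<^sup>2) \<longlonglongrightarrow> 0"
    by (rule summable_LIMSEQ_zero)
  then have "(\<lambda>k. (norm (displacement (s k) - displacement (u k)))\<^sup>2) \<longlonglongrightarrow> 0"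
    using c_pos tendsto_mult_left_zero[of _ sequentially "1 / c"] by simp
  then have "(\<lambda>k. sqrt ((norm (displacement (s k) - displacement (u k)))\<^sup>2)) \<longlonglongrightarrow> sqrt 0"
    by (rule tendsto_real_sqrt)
  then show ?thesis by (simp add: tendsto_norm_zero_iff)
qed

lemma exists_displacement_eq_shift:
  assumes "\<epsilon> > 0"
  shows "\<exists>x. displacement x = m - \<epsilon> *\<^sub>R x"
proof -
  define f where "f x = (1 / (1 + \<epsilon>)) *\<^sub>R (T x + m)" for x
  have "\<exists>!x. f x = x"
  proof (rule banach_fix_type)
    show "\<forall>x y. dist (f x) (f y) \<le> 1 / (1 + \<epsilon>) * dist x y"
    proof (intro allI)
      fix x y
      have "f x - f y = (1 / (1 + \<epsilon>)) *\<^sub>R (T x - T y)"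
        unfolding f_def by (simp add: algebra_simps)
      then show "dist (f x) (f y) \<le> 1 / (1 + \<epsilon>) * dist x y"
        using nonexpansive[of x y] assms by (simp add: dist_norm divide_right_mono)
    qed
  qed (use assms in auto)
  then obtain x where "f x = x" by blast
  then have "(1 + \<epsilon>) *\<^sub>R x = (1 + \<epsilon>) *\<^sub>R ((1 / (1 + \<epsilon>)) *\<^sub>R (T x + m))"
    unfolding f_def by simp
  also have "\<dots> = T x + m" using assms by simp
  finally show ?thesis unfolding displacement_def by (auto simp: algebra_simps)
qed

lemma shifted_point_estimate:
  assumes "\<epsilon> > 0"
    and x: "displacement x = (1/2) *\<^sub>R (displacement y + displacement y') - \<epsilon> *\<^sub>R x"
  shows "(\<epsilon> * norm x)\<^sup>2 \<le> \<epsilon> * norm (y + y') * (\<epsilon> * norm x)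
           + \<epsilon> * inner (displacement y - displacement y') (y - y')"
proof -
  define a b where "a = displacement y" and "b = displacement y'"
  define K where "K = inner (a - b) (y - y')"
  have K: "0 \<le> K" unfolding K_def a_def b_def by (rule displacement_monotone)
  have "0 \<le> inner (displacement x - a) (x - y) + inner (displacement x - b) (x - y')"
    unfolding a_def b_def using displacement_monotone by (simp add: add_nonneg_nonneg)
  also have "\<dots> = K / 2 - 2 * \<epsilon> * inner x x + \<epsilon> * inner x (y + y')"
    unfolding x K_def a_def b_def
    by (simp add: inner_simps algebra_simps inner_commute diff_divide_distrib add_divide_distrib)
  also have "\<dots> \<le> K / 2 - 2 * \<epsilon> * (norm x)\<^sup>2 + \<epsilon> * (norm x * norm (y + y'))"
    using norm_cauchy_schwarz[of x "y + y'"] assms(1) by (simp add: power2_norm_eq_inner)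
  finally have "0 \<le> \<epsilon> * (K / 2 - 2 * \<epsilon> * (norm x)\<^sup>2 + \<epsilon> * (norm x * norm (y + y')))"
    using assms(1) by simp
  also have "\<dots> = \<epsilon> * K / 2 - 2 * (\<epsilon> * norm x)\<^sup>2 + \<epsilon> * norm (y + y') * (\<epsilon> * norm x)"
    by (simp add: power2_eq_square algebra_simps)
  finally have "2 * (\<epsilon> * norm x)\<^sup>2 \<le> \<epsilon> * K / 2 + \<epsilon> * norm (y + y') * (\<epsilon> * norm x)"
    by simp
  moreover have "0 \<le> \<epsilon> * K" using K assms(1) by simp
  ultimately have "(\<epsilon> * norm x)\<^sup>2 \<le> \<epsilon> * norm (y + y') * (\<epsilon> * norm x) + \<epsilon> * K"
    using zero_le_power2[of "\<epsilon> * norm x"] by linarith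
  then show ?thesis unfolding K_def a_def b_def .
qed

text \<open>Convexity of \<open>closure (range displacement)\<close>, the heart of Pazy's theorem: the solution \<open>x\<close>
  of \<open>displacement x + \<epsilon> x = midpoint\<close> misses the midpoint by \<open>\<epsilon> x\<close>, and monotonicity of
  \<open>displacement\<close> forces \<open>\<epsilon> x \<rightarrow> 0\<close> as \<open>\<epsilon> \<rightarrow> 0\<close>.\<close>
lemma midpoint_displacements_in_closure:
  "(1/2) *\<^sub>R (displacement y + displacement y') \<in> closure (range displacement)"
  unfolding closure_approachable
proof (intro allI impI)
  fix \<eta> :: real assume "\<eta> > 0"
  define N K where "N = norm (y + y')"
    and "K = inner (displacement y - displacement y') (y - y')"
  have "((\<lambda>\<epsilon>. \<epsilon> * N + sqrt (\<epsilon> * K)) \<longlongrightarrow> 0 * N + sqrt (0 * K)) (at_right 0)"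
    by (intro tendsto_intros)
  then have "\<forall>\<^sub>F \<epsilon> in at_right 0. \<epsilon> * N + sqrt (\<epsilon> * K) < \<eta>"
    using \<open>\<eta> > 0\<close> by (simp add: order_tendsto_iff)
  then obtain b where "b > 0" and b: "\<And>\<epsilon>. 0 < \<epsilon> \<Longrightarrow> \<epsilon> < b \<Longrightarrow> \<epsilon> * N + sqrt (\<epsilon> * K) < \<eta>"
    unfolding eventually_at_right_field by auto
  define \<epsilon> where "\<epsilon> = b / 2"
  have "\<epsilon> > 0" "\<epsilon> < b" unfolding \<epsilon>_def using \<open>b > 0\<close> by simp_all
  obtain x where x: "displacement x = (1/2) *\<^sub>R (displacement y + displacement y') - \<epsilon> *\<^sub>R x"
    using exists_displacement_eq_shift[OF \<open>\<epsilon> > 0\<close>] by blast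
  have "dist (displacement x) ((1/2) *\<^sub>R (displacement y + displacement y')) = \<epsilon> * norm x"
    unfolding x dist_norm using \<open>\<epsilon> > 0\<close> by simp
  also have "\<dots> \<le> \<epsilon> * N + sqrt (\<epsilon> * K)"
    using shifted_point_estimate[OF \<open>\<epsilon> > 0\<close> x] \<open>\<epsilon> > 0\<close> displacement_monotone[of y y']
    unfolding N_def K_def by (intro le_add_sqrt_if_square_le) auto
  also have "\<dots> < \<eta>" using b \<open>\<epsilon> > 0\<close> \<open>\<epsilon> < b\<close> by blast
  finally show "\<exists>z\<in>range displacement. dist z ((1/2) *\<^sub>R (displacement y + displacement y')) < \<eta>"
    by blast
qed

lemma convergent_displacement_orbit: "convergent (\<lambda>k. displacement ((T ^^ k) x))"
proof -
  define g where "g k = norm (displacement ((T ^^ k) x))" for k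
  have "decseq g" unfolding g_def by (rule decseq_SucI) (simp add: norm_displacement_T_le)
  then obtain L where gL: "g \<longlonglongrightarrow> L" and L_le: "\<And>k. L \<le> g k"
    using decseq_convergent[of g 0] unfolding g_def by auto
  have "0 \<le> L" using LIMSEQ_le_const[OF gL, of 0] unfolding g_def by simp
  have L_le_displacement: "L \<le> norm (displacement y)" for y
  proof -
    have "(\<lambda>k. displacement ((T ^^ k) x) - displacement ((T ^^ k) y)) \<longlonglongrightarrow> 0"
      by (rule displacement_perturbed_orbit_tendsto[where e = "\<lambda>_. 0"]) simp_all
    then have "(\<lambda>k. norm (displacement y) + norm (displacement ((T ^^ k) x) - displacement ((T ^^ k) y)))
        \<longlonglongrightarrow> norm (displacement y) + 0"
      by (intro tendsto_add tendsto_const tendsto_norm_zero)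
    moreover have "g k \<le> norm (displacement y) + norm (displacement ((T ^^ k) x) - displacement ((T ^^ k) y))" for k
      using norm_displacement_funpow_le[of k y] unfolding g_def by (smt (verit) norm_triangle_ineq2)
    ultimately show ?thesis using LIMSEQ_le[OF gL] by auto
  qed
  have "closure (range displacement) \<subseteq> {z. L \<le> norm z}"
    using L_le_displacement by (intro closure_minimal) (auto intro: closed_Collect_le continuous_intros)
  then have L_le_midpoint: "L \<le> norm ((1/2) *\<^sub>R (displacement y + displacement y'))" for y y'
    using midpoint_displacements_in_closure by blast
  have "Cauchy (\<lambda>k. displacement ((T ^^ k) x))"
  proof (rule CauchyI)
    fix \<epsilon> :: real assume "0 < \<epsilon>"
    have "(\<lambda>k. (g k)\<^sup>2) \<longlonglongrightarrow> L\<^sup>2" by (intro tendsto_power gL)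
    then have "\<forall>\<^sub>F k in sequentially. (g k)\<^sup>2 < L\<^sup>2 + \<epsilon>\<^sup>2 / 4"
      using \<open>0 < \<epsilon>\<close> by (intro order_tendstoD) auto
    then obtain N where "\<And>k. k \<ge> N \<Longrightarrow> (g k)\<^sup>2 < L\<^sup>2 + \<epsilon>\<^sup>2 / 4"
      unfolding eventually_sequentially by blast
    then show "\<exists>N. \<forall>m\<ge>N. \<forall>n\<ge>N. norm (displacement ((T ^^ m) x) - displacement ((T ^^ n) x)) < \<epsilon>"
      using norm_diff_less_if_midpoint_norm_ge[OF \<open>0 \<le> L\<close> \<open>0 < \<epsilon>\<close> L_le_midpoint]
      unfolding g_def by blast
  qed
  then show ?thesis by (simp add: Cauchy_convergent_iff)
qed

definition asymptotic_displacement :: 'a where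
  "asymptotic_displacement = lim (\<lambda>k. displacement ((T ^^ k) 0))"

lemma perturbed_orbit_increment_tendsto:
  assumes s: "\<And>k. s (Suc k) = T (s k) + e k" and e: "summable (\<lambda>k. norm (e k))"
  shows "(\<lambda>k. s (Suc k) - s k) \<longlonglongrightarrow> - asymptotic_displacement"
proof -
  define u where "u k = (T ^^ k) 0" for k
  have "(\<lambda>k. displacement (u k)) \<longlonglongrightarrow> asymptotic_displacement"
    using convergent_displacement_orbit unfolding u_def asymptotic_displacement_def
    by (simp add: convergent_LIMSEQ_iff)
  moreover have "(\<lambda>k. displacement (s k) - displacement (u k)) \<longlonglongrightarrow> 0"
    by (rule displacement_perturbed_orbit_tendsto[OF s e]) (simp add: u_def)
  moreover have "e \<longlonglongrightarrow> 0"
    using summable_LIMSEQ_zero[OF e] by (simp add: tendsto_norm_zero_iff)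
  ultimately have "(\<lambda>k. e k - (displacement (u k) + (displacement (s k) - displacement (u k))))
      \<longlonglongrightarrow> 0 - (asymptotic_displacement + 0)"
    by (intro tendsto_intros)
  moreover have "s (Suc k) - s k = e k - (displacement (u k) + (displacement (s k) - displacement (u k)))" for k
    using s unfolding displacement_def by (simp add: algebra_simps)
  ultimately show ?thesis by simp
qed

end

declare transpose_matrix_vector [simp del]

lemma inner_transpose_mult:
  "inner (\<xi>::real^'n) (transpose (A::real^'n^'m) *v w) = inner (A *v \<xi>) w"
  by (metis dot_lmul_matrix inner_commute transpose_matrix_vector)

lemma norm_matrix_vector_mult_le: "norm ((A::real^'n^'m) *v x) \<le> onorm ((*v) A) * norm x"
  by (rule onorm) simp

lemma onorm_matrix_vector_mult_nonneg: "0 \<le> onorm ((*v) (A::real^'n^'m))"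
  by (rule onorm_pos_le) simp

lemma linear_restr: "linear (restr S)"
  unfolding restr_def by (rule linearI) (simp_all add: vec_eq_iff)

lemma restr_eq_self_iff: "restr S v = v \<longleftrightarrow> (\<forall>i. i \<notin> S \<longrightarrow> v $ i = 0)"
  by (auto simp: restr_def vec_eq_iff)

lemma product_compact_cone_closed_convex_nonempty:
  assumes "product_compact_cone C"
  shows "closed C" "convex C" "C \<noteq> {}"
proof -
  obtain S D K b where D: "D \<noteq> {}" "compact D" "convex D" "\<forall>d\<in>D. restr S d = d"
    and K: "K \<noteq> {}" "closed K" "convex K" "\<forall>v\<in>K. restr (- S) v = v"
    and b: "restr (- S) b = b"
    and C: "C = {z. restr S z \<in> D \<and> restr (- S) z \<in> (\<lambda>v. b + v) ` K}"
    using assms unfolding product_compact_cone_def by blast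
  have C_vimage: "C = restr S -` D \<inter> restr (- S) -` ((+) b ` K)" unfolding C by auto
  have "continuous (at x) (restr T)" for T x
    using linear_restr by (intro linear_continuous_at) (simp add: linear_conv_bounded_linear)
  then show "closed C" unfolding C_vimage
    by (intro closed_Int continuous_closed_vimage closed_translation compact_imp_closed D K)
  show "convex C" unfolding C_vimage
    by (intro convex_Int convex_linear_vimage convex_translation linear_restr D K)
  obtain d w where d: "d \<in> D" and w: "w \<in> K" using D K by blast
  have "restr S (d + b + w) = d" "restr (- S) (d + b + w) = b + w"
    using D(4) K(4) b d w by (auto simp: restr_eq_self_iff) (auto simp: restr_def vec_eq_iff)
  then have "d + b + w \<in> C" unfolding C using d w by auto
  then show "C \<noteq> {}" by blast
qed

locale admm =
  fixes P :: "real^'n^'n" and q :: "real^'n" and A :: "real^'n^'m" and C :: "(real^'m) set"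
    and \<rho> \<sigma> \<alpha> :: real
  assumes P_psd: "\<forall>v. 0 \<le> v \<bullet> (P *v v)" and rho: "\<rho> > 0" and sigma: "\<sigma> > 0"
    and alpha: "0 < \<alpha>" "\<alpha> < 2"
    and C_closed: "closed C" and C_convex: "convex C" and C_nonempty: "C \<noteq> {}"
begin

text \<open>Eliminating \<open>\<hat>z = A \<hat>x\<close> from the linear system of step 1 leaves \<open>Q \<hat>x = rhs\<close>.\<close>
definition Q :: "real^'n \<Rightarrow> real^'n" where
  "Q \<xi> = P *v \<xi> + \<sigma> *\<^sub>R \<xi> + \<rho> *\<^sub>R (transpose A *v (A *v \<xi>))"

lemma linear_Q: "linear Q"
  unfolding Q_def by (rule linearI) (simp_all add: algebra_simps)

lemma inner_Q_ge: "\<sigma> * (norm \<xi>)\<^sup>2 + \<rho> * (norm (A *v \<xi>))\<^sup>2 \<le> inner \<xi> (Q \<xi>)"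
proof -
  have "inner \<xi> (Q \<xi>) = inner \<xi> (P *v \<xi>) + \<sigma> * (norm \<xi>)\<^sup>2 + \<rho> * (norm (A *v \<xi>))\<^sup>2"
    unfolding Q_def by (simp add: inner_simps inner_transpose_mult power2_norm_eq_inner)
  then show ?thesis using P_psd by simp
qed

lemma norm_Q_ge: "\<sigma> * norm \<xi> \<le> norm (Q \<xi>)"
proof (cases "\<xi> = 0")
  case False
  have "\<sigma> * (norm \<xi>)\<^sup>2 \<le> inner \<xi> (Q \<xi>)"
    using inner_Q_ge[of \<xi>] rho by (smt (verit) mult_nonneg_nonneg zero_le_power2)
  also have "\<dots> \<le> norm \<xi> * norm (Q \<xi>)" by (rule norm_cauchy_schwarz)
  finally show ?thesis using False by (simp add: power2_eq_square mult.commute)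
qed simp

lemma bij_Q: "bij Q"
proof -
  have "inj Q"
  proof (rule injI)
    fix a b assume "Q a = Q b"
    then have "\<sigma> * norm (a - b) \<le> 0"
      using norm_Q_ge[of "a - b"] linear_diff[OF linear_Q] by simp
    then show "a = b" using sigma by (simp add: mult_le_0_iff)
  qed
  then show ?thesis using linear_injective_imp_surjective[OF linear_Q] by (simp add: bij_def)
qed

lemma Q_inv_Q [simp]: "Q (inv Q w) = w"
  using bij_Q by (simp add: bij_is_surj surj_f_inv_f)

lemma inv_Q_eqI: "Q \<xi> = w \<Longrightarrow> inv Q w = \<xi>"
  using bij_Q by (auto simp: bij_is_inj inv_f_f)

lemma norm_inv_Q_diff_le: "norm (inv Q w - inv Q w') \<le> norm (w - w') / \<sigma>"
  using norm_Q_ge[of "inv Q w - inv Q w'"] linear_diff[OF linear_Q, of "inv Q w" "inv Q w'"] sigma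
  by (simp add: pos_le_divide_eq mult.commute)

text \<open>In the variables \<open>(\<surd>\<sigma> x, \<surd>\<rho> (z + y / \<rho>))\<close> an exact ADMM step is the relaxed
  Douglas--Rachford step \<open>T_admm\<close> built from the resolvents \<open>J_quad\<close> of the quadratic part and
  \<open>J_proj\<close> of the indicator of \<open>C\<close>; see \<open>T_admm_scaled\<close>.\<close>
definition J_quad :: "(real^'n) \<times> (real^'m) \<Rightarrow> (real^'n) \<times> (real^'m)" where
  "J_quad p = (let \<xi> = inv Q (sqrt \<sigma> *\<^sub>R fst p + sqrt \<rho> *\<^sub>R (transpose A *v snd p) - q)
               in (sqrt \<sigma> *\<^sub>R \<xi>, sqrt \<rho> *\<^sub>R (A *v \<xi>)))"

definition J_proj :: "(real^'n) \<times> (real^'m) \<Rightarrow> (real^'n) \<times> (real^'m)" where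
  "J_proj p = (fst p, sqrt \<rho> *\<^sub>R closest_point C ((1 / sqrt \<rho>) *\<^sub>R snd p))"

definition T_admm :: "(real^'n) \<times> (real^'m) \<Rightarrow> (real^'n) \<times> (real^'m)" where
  "T_admm p = (1 - \<alpha>/2) *\<^sub>R p + (\<alpha>/2) *\<^sub>R reflection J_quad (reflection J_proj p)"

definition admm_state :: "real^'n \<Rightarrow> real^'m \<Rightarrow> real^'m \<Rightarrow> (real^'n) \<times> (real^'m)" where
  "admm_state x z y = (sqrt \<sigma> *\<^sub>R x, sqrt \<rho> *\<^sub>R (z + (1 / \<rho>) *\<^sub>R y))"

lemma firmly_nonexpansive_J_quad: "firmly_nonexpansive J_quad"
  unfolding firmly_nonexpansive_def
proof (intro allI)
  fix p p' :: "(real^'n) \<times> (real^'m)"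
  obtain a b a' b' where p: "p = (a, b)" and p': "p' = (a', b')" by fastforce
  define \<xi> where "\<xi> = inv Q (sqrt \<sigma> *\<^sub>R a + sqrt \<rho> *\<^sub>R (transpose A *v b) - q)"
  define \<xi>' where "\<xi>' = inv Q (sqrt \<sigma> *\<^sub>R a' + sqrt \<rho> *\<^sub>R (transpose A *v b') - q)"
  define d where "d = \<xi> - \<xi>'"
  have Qd: "Q d = sqrt \<sigma> *\<^sub>R (a - a') + sqrt \<rho> *\<^sub>R (transpose A *v (b - b'))"
    unfolding d_def \<xi>_def \<xi>'_def linear_diff[OF linear_Q]
    by (simp add: algebra_simps matrix_vector_mult_diff_distrib)
  have "J_quad p = (sqrt \<sigma> *\<^sub>R \<xi>, sqrt \<rho> *\<^sub>R (A *v \<xi>))"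
    and "J_quad p' = (sqrt \<sigma> *\<^sub>R \<xi>', sqrt \<rho> *\<^sub>R (A *v \<xi>'))"
    unfolding J_quad_def p p' \<xi>_def \<xi>'_def by (simp_all add: Let_def)
  then have J: "J_quad p - J_quad p' = (sqrt \<sigma> *\<^sub>R d, sqrt \<rho> *\<^sub>R (A *v d))"
    unfolding d_def by (simp add: algebra_simps matrix_vector_mult_diff_distrib)
  have "(norm (J_quad p - J_quad p'))\<^sup>2 = \<sigma> * (norm d)\<^sup>2 + \<rho> * (norm (A *v d))\<^sup>2"
    unfolding J power2_norm_Pair using sigma rho by (simp add: power_mult_distrib)
  also have "\<dots> \<le> inner d (Q d)" by (rule inner_Q_ge)
  also have "\<dots> = inner (J_quad p - J_quad p') (p - p')"
    unfolding J Qd by (simp add: p p' inner_simps inner_transpose_mult algebra_simps)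
  finally show "(norm (J_quad p - J_quad p'))\<^sup>2 \<le> inner (J_quad p - J_quad p') (p - p')" .
qed

lemma firmly_nonexpansive_J_proj: "firmly_nonexpansive J_proj"
  unfolding firmly_nonexpansive_def
proof (intro allI)
  fix p p' :: "(real^'n) \<times> (real^'m)"
  obtain a b a' b' where p: "p = (a, b)" and p': "p' = (a', b')" by fastforce
  define v v' where "v = (1 / sqrt \<rho>) *\<^sub>R b" and "v' = (1 / sqrt \<rho>) *\<^sub>R b'"
  let ?dP = "closest_point C v - closest_point C v'"
  have "b = sqrt \<rho> *\<^sub>R v" "b' = sqrt \<rho> *\<^sub>R v'" unfolding v_def v'_def using rho by simp_all
  then have b: "b - b' = sqrt \<rho> *\<^sub>R (v - v')" by (simp add: scaleR_diff_right)
  have J: "J_proj p - J_proj p' = (a - a', sqrt \<rho> *\<^sub>R ?dP)"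
    unfolding J_proj_def p p' v_def v'_def by (simp add: algebra_simps)
  have "(norm ?dP)\<^sup>2 \<le> inner ?dP (v - v')"
    using firmly_nonexpansive_closest_point[OF C_convex C_closed C_nonempty]
    unfolding firmly_nonexpansive_def by blast
  then show "(norm (J_proj p - J_proj p'))\<^sup>2 \<le> inner (J_proj p - J_proj p') (p - p')"
    unfolding J power2_norm_Pair using rho
    by (simp add: p p' b power_mult_distrib power2_norm_eq_inner flip: mult.assoc)
qed

sublocale T: averaged_operator T_admm "(2 - \<alpha>) / \<alpha>"
proof -
  have "averaged_operator T_admm ((1 - \<alpha>/2) / (\<alpha>/2))"
    unfolding T_admm_def using alpha
    by (intro averaged_operator_relaxed_reflections firmly_nonexpansive_J_quad
        firmly_nonexpansive_J_proj) auto
  moreover have "(1 - \<alpha>/2) / (\<alpha>/2) = (2 - \<alpha>) / \<alpha>" using alpha by (simp add: field_simps)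
  ultimately show "averaged_operator T_admm ((2 - \<alpha>) / \<alpha>)" by simp
qed

lemma T_admm_scaled:
  fixes x :: "real^'n" and v :: "real^'m"
  defines "\<xi> \<equiv> inv Q (\<sigma> *\<^sub>R x + \<rho> *\<^sub>R (transpose A *v (2 *\<^sub>R closest_point C v - v)) - q)"
  shows "T_admm (sqrt \<sigma> *\<^sub>R x, sqrt \<rho> *\<^sub>R v) =
    (sqrt \<sigma> *\<^sub>R (\<alpha> *\<^sub>R \<xi> + (1 - \<alpha>) *\<^sub>R x), sqrt \<rho> *\<^sub>R (v + \<alpha> *\<^sub>R (A *v \<xi> - closest_point C v)))"
proof -
  have R: "reflection J_proj (sqrt \<sigma> *\<^sub>R x, sqrt \<rho> *\<^sub>R v)
      = (sqrt \<sigma> *\<^sub>R x, sqrt \<rho> *\<^sub>R (2 *\<^sub>R closest_point C v - v))"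
    unfolding reflection_def J_proj_def using rho by (simp add: vec_eq_iff algebra_simps)
  have "sqrt \<sigma> *\<^sub>R (sqrt \<sigma> *\<^sub>R x) + sqrt \<rho> *\<^sub>R (transpose A *v (sqrt \<rho> *\<^sub>R (2 *\<^sub>R closest_point C v - v))) - q
      = \<sigma> *\<^sub>R x + \<rho> *\<^sub>R (transpose A *v (2 *\<^sub>R closest_point C v - v)) - q"
    using sigma rho by (simp add: matrix_vector_mult_scaleR)
  then have "J_quad (sqrt \<sigma> *\<^sub>R x, sqrt \<rho> *\<^sub>R (2 *\<^sub>R closest_point C v - v))
      = (sqrt \<sigma> *\<^sub>R \<xi>, sqrt \<rho> *\<^sub>R (A *v \<xi>))"
    unfolding J_quad_def Let_def \<xi>_def by simp
  then show ?thesis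
    unfolding T_admm_def R by (simp add: reflection_def vec_eq_iff algebra_simps)
qed

lemma approx_admm_stepD:
  assumes "approx_admm P q A C \<rho> \<sigma> \<alpha> \<mu> \<nu> x z y xt zt"
  shows "\<exists>\<xi>. Q \<xi> = \<sigma> *\<^sub>R x k + \<rho> *\<^sub>R (transpose A *v (z k - (1 / \<rho>) *\<^sub>R y k)) - q
          \<and> norm (xt (Suc k) - \<xi>) \<le> \<mu> k \<and> norm (zt (Suc k) - A *v \<xi>) \<le> \<mu> k"
    and "x (Suc k) = \<alpha> *\<^sub>R xt (Suc k) + (1 - \<alpha>) *\<^sub>R x k"
    and "z (Suc k) + (1 / \<rho>) *\<^sub>R y (Suc k) = \<alpha> *\<^sub>R zt (Suc k) + (1 - \<alpha>) *\<^sub>R z k + (1 / \<rho>) *\<^sub>R y k"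
    and "norm (z (Suc k) - closest_point C (z (Suc k) + (1 / \<rho>) *\<^sub>R y (Suc k))) \<le> \<nu> k"
proof -
  obtain \<xi> \<zeta> where Q: "P *v \<xi> + \<sigma> *\<^sub>R \<xi> + \<rho> *\<^sub>R (transpose A *v \<zeta>)
           = \<sigma> *\<^sub>R x k + \<rho> *\<^sub>R (transpose A *v (z k - (1 / \<rho>) *\<^sub>R y k)) - q"
    and \<zeta>: "\<rho> *\<^sub>R (A *v \<xi>) - \<rho> *\<^sub>R \<zeta> = 0"
    and err: "sqrt ((norm (xt (Suc k) - \<xi>))\<^sup>2 + (norm (zt (Suc k) - \<zeta>))\<^sup>2) \<le> \<mu> k"
    using assms unfolding approx_admm_def by blast
  have "\<zeta> = A *v \<xi>" using \<zeta> rho by (simp flip: scaleR_diff_right)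
  moreover have "norm (xt (Suc k) - \<xi>) \<le> \<mu> k" "norm (zt (Suc k) - \<zeta>) \<le> \<mu> k"
    using order_trans[OF real_le_rsqrt err] by simp_all
  ultimately show "\<exists>\<xi>. Q \<xi> = \<sigma> *\<^sub>R x k + \<rho> *\<^sub>R (transpose A *v (z k - (1 / \<rho>) *\<^sub>R y k)) - q
      \<and> norm (xt (Suc k) - \<xi>) \<le> \<mu> k \<and> norm (zt (Suc k) - A *v \<xi>) \<le> \<mu> k"
    using Q unfolding Q_def by blast
  show "x (Suc k) = \<alpha> *\<^sub>R xt (Suc k) + (1 - \<alpha>) *\<^sub>R x k"
    using assms unfolding approx_admm_def by blast
  have y: "y (Suc k) = y k + \<rho> *\<^sub>R (\<alpha> *\<^sub>R zt (Suc k) + (1 - \<alpha>) *\<^sub>R z k - z (Suc k))"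
    using assms unfolding approx_admm_def by blast
  show V: "z (Suc k) + (1 / \<rho>) *\<^sub>R y (Suc k) = \<alpha> *\<^sub>R zt (Suc k) + (1 - \<alpha>) *\<^sub>R z k + (1 / \<rho>) *\<^sub>R y k"
    unfolding y using rho by (simp add: algebra_simps)
  have "dist (z (Suc k))
      (closest_point C (\<alpha> *\<^sub>R zt (Suc k) + (1 - \<alpha>) *\<^sub>R z k + (1 / \<rho>) *\<^sub>R y k)) \<le> \<nu> k"
    using assms unfolding approx_admm_def by blast
  then show "norm (z (Suc k) - closest_point C (z (Suc k) + (1 / \<rho>) *\<^sub>R y (Suc k))) \<le> \<nu> k"
    unfolding V dist_norm .
qed

lemma norm_x_update_diff_le:
  "norm (inv Q (\<sigma> *\<^sub>R x + \<rho> *\<^sub>R (transpose A *v u) - q) - inv Q (\<sigma> *\<^sub>R x + \<rho> *\<^sub>R (transpose A *v u') - q))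
    \<le> \<rho> * onorm ((*v) (transpose A)) * norm (u - u') / \<sigma>"
proof -
  have "(\<sigma> *\<^sub>R x + \<rho> *\<^sub>R (transpose A *v u) - q) - (\<sigma> *\<^sub>R x + \<rho> *\<^sub>R (transpose A *v u') - q)
      = \<rho> *\<^sub>R (transpose A *v (u - u'))"
    by (simp add: algebra_simps)
  then have "norm (inv Q (\<sigma> *\<^sub>R x + \<rho> *\<^sub>R (transpose A *v u) - q) - inv Q (\<sigma> *\<^sub>R x + \<rho> *\<^sub>R (transpose A *v u') - q))
      \<le> \<rho> * norm (transpose A *v (u - u')) / \<sigma>"
    using norm_inv_Q_diff_le rho by (metis abs_of_pos norm_scaleR)
  also have "\<dots> \<le> \<rho> * (onorm ((*v) (transpose A)) * norm (u - u')) / \<sigma>"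
    using norm_matrix_vector_mult_le rho sigma by (intro divide_right_mono mult_left_mono) auto
  finally show ?thesis by (simp add: mult.assoc)
qed

text \<open>The projection error of step \<open>k\<close> enters the linear system of step \<open>k + 1\<close>, hence
  the shift between \<open>\<mu>\<close> and \<open>\<nu>\<close>.\<close>
lemma approx_admm_state_step_error:
  assumes adm: "approx_admm P q A C \<rho> \<sigma> \<alpha> \<mu> \<nu> x z y xt zt"
  defines "S \<equiv> \<lambda>k. admm_state (x k) (z k) (y k)"
    and "a \<equiv> onorm ((*v) A)" and "c \<equiv> 2 * \<rho> * onorm ((*v) (transpose A)) / \<sigma>"
  shows "norm (S (Suc (Suc k)) - T_admm (S (Suc k)))
    \<le> sqrt \<sigma> * \<alpha> * (\<mu> (Suc k) + c * \<nu> k) + sqrt \<rho> * \<alpha> * (\<mu> (Suc k) + a * (c * \<nu> k) + \<nu> k)"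
proof -
  define n where "n = Suc k"
  define V where "V = z n + (1 / \<rho>) *\<^sub>R y n"
  define e where "e = z n - closest_point C V"
  have e: "norm e \<le> \<nu> k" using approx_admm_stepD(4)[OF adm, of k] unfolding e_def V_def n_def .
  obtain \<xi> where \<xi>: "Q \<xi> = \<sigma> *\<^sub>R x n + \<rho> *\<^sub>R (transpose A *v (z n - (1 / \<rho>) *\<^sub>R y n)) - q"
    and xt: "norm (xt (Suc n) - \<xi>) \<le> \<mu> n" and zt: "norm (zt (Suc n) - A *v \<xi>) \<le> \<mu> n"
    using approx_admm_stepD(1)[OF adm, of n] by blast
  define \<xi>\<^sub>0 where "\<xi>\<^sub>0 = inv Q (\<sigma> *\<^sub>R x n + \<rho> *\<^sub>R (transpose A *v (2 *\<^sub>R closest_point C V - V)) - q)"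
  have "(z n - (1 / \<rho>) *\<^sub>R y n) - (2 *\<^sub>R closest_point C V - V) = 2 *\<^sub>R e"
    unfolding e_def V_def by (simp add: vec_eq_iff algebra_simps)
  then have "norm (\<xi> - \<xi>\<^sub>0) \<le> \<rho> * onorm ((*v) (transpose A)) * norm (2 *\<^sub>R e) / \<sigma>"
    using norm_x_update_diff_le[of "x n" "z n - (1 / \<rho>) *\<^sub>R y n" "2 *\<^sub>R closest_point C V - V"]
    unfolding \<xi>\<^sub>0_def inv_Q_eqI[OF \<xi>] by simp
  also have "\<dots> \<le> c * \<nu> k"
    using e rho sigma onorm_matrix_vector_mult_nonneg[of "transpose A"] unfolding c_def
    by (simp add: field_simps mult_right_mono)
  finally have \<xi>\<^sub>0: "norm (\<xi> - \<xi>\<^sub>0) \<le> c * \<nu> k" .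
  have "S n = (sqrt \<sigma> *\<^sub>R x n, sqrt \<rho> *\<^sub>R V)" unfolding S_def admm_state_def V_def ..
  then have "T_admm (S n) = (sqrt \<sigma> *\<^sub>R (\<alpha> *\<^sub>R \<xi>\<^sub>0 + (1 - \<alpha>) *\<^sub>R x n),
      sqrt \<rho> *\<^sub>R (V + \<alpha> *\<^sub>R (A *v \<xi>\<^sub>0 - closest_point C V)))"
    unfolding \<xi>\<^sub>0_def by (simp add: T_admm_scaled)
  moreover have "S (Suc n) = (sqrt \<sigma> *\<^sub>R (\<alpha> *\<^sub>R xt (Suc n) + (1 - \<alpha>) *\<^sub>R x n),
      sqrt \<rho> *\<^sub>R (\<alpha> *\<^sub>R zt (Suc n) + (1 - \<alpha>) *\<^sub>R z n + (1 / \<rho>) *\<^sub>R y n))"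
    unfolding S_def admm_state_def using approx_admm_stepD(2,3)[OF adm, of n] by simp
  ultimately have "S (Suc n) - T_admm (S n) = ((sqrt \<sigma> * \<alpha>) *\<^sub>R (xt (Suc n) - \<xi>\<^sub>0),
      (sqrt \<rho> * \<alpha>) *\<^sub>R ((zt (Suc n) - A *v \<xi>) + A *v (\<xi> - \<xi>\<^sub>0) - e))"
    unfolding e_def V_def by (simp add: vec_eq_iff algebra_simps)
  then have "norm (S (Suc n) - T_admm (S n)) \<le> norm ((sqrt \<sigma> * \<alpha>) *\<^sub>R (xt (Suc n) - \<xi>\<^sub>0))
      + norm ((sqrt \<rho> * \<alpha>) *\<^sub>R ((zt (Suc n) - A *v \<xi>) + A *v (\<xi> - \<xi>\<^sub>0) - e))"
    by (simp only: norm_Pair_le)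
  also have "\<dots> = sqrt \<sigma> * \<alpha> * norm (xt (Suc n) - \<xi>\<^sub>0)
      + sqrt \<rho> * \<alpha> * norm ((zt (Suc n) - A *v \<xi>) + A *v (\<xi> - \<xi>\<^sub>0) - e)"
    using alpha sigma rho by (simp add: abs_mult)
  also have "\<dots> \<le> sqrt \<sigma> * \<alpha> * (\<mu> n + c * \<nu> k) + sqrt \<rho> * \<alpha> * (\<mu> n + a * (c * \<nu> k) + \<nu> k)"
  proof (intro add_mono mult_left_mono)
    show "norm (xt (Suc n) - \<xi>\<^sub>0) \<le> \<mu> n + c * \<nu> k"
      using xt \<xi>\<^sub>0 norm_triangle_ineq[of "xt (Suc n) - \<xi>" "\<xi> - \<xi>\<^sub>0"] by simp
    have "norm (A *v (\<xi> - \<xi>\<^sub>0)) \<le> a * (c * \<nu> k)"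
      using norm_matrix_vector_mult_le[of A "\<xi> - \<xi>\<^sub>0"] \<xi>\<^sub>0 onorm_matrix_vector_mult_nonneg[of A]
      unfolding a_def by (meson mult_left_mono order_trans)
    then show "norm ((zt (Suc n) - A *v \<xi>) + A *v (\<xi> - \<xi>\<^sub>0) - e) \<le> \<mu> n + a * (c * \<nu> k) + \<nu> k"
      using zt e norm_triangle_ineq[of "zt (Suc n) - A *v \<xi>" "A *v (\<xi> - \<xi>\<^sub>0)"]
        norm_triangle_ineq4[of "(zt (Suc n) - A *v \<xi>) + A *v (\<xi> - \<xi>\<^sub>0)" e] by linarith
  qed (use alpha sigma rho in auto)
  finally show ?thesis unfolding n_def .
qed

lemma approx_admm_state_error:
  assumes adm: "approx_admm P q A C \<rho> \<sigma> \<alpha> \<mu> \<nu> x z y xt zt"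
    and "\<forall>k. 0 \<le> \<mu> k" "\<forall>k. 0 \<le> \<nu> k"
  defines "S \<equiv> \<lambda>k. admm_state (x k) (z k) (y k)"
  shows "\<exists>K\<ge>0. \<forall>k. norm (S (Suc (Suc k)) - T_admm (S (Suc k))) \<le> K * (\<mu> (Suc k) + \<nu> k)"
proof -
  define a c where "a = onorm ((*v) A)" and "c = 2 * \<rho> * onorm ((*v) (transpose A)) / \<sigma>"
  have "0 \<le> a" "0 \<le> c"
    unfolding a_def c_def using rho sigma by (simp_all add: onorm_matrix_vector_mult_nonneg)
  define K where "K = sqrt \<sigma> * \<alpha> * (1 + c) + sqrt \<rho> * \<alpha> * (2 + a * c)"
  show ?thesis
  proof (intro exI conjI allI)
    show "0 \<le> K" unfolding K_def using \<open>0 \<le> a\<close> \<open>0 \<le> c\<close> alpha sigma rho by simp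
    fix k
    have "0 \<le> \<mu> (Suc k)" "0 \<le> \<nu> k" "0 \<le> a * c" using assms(2,3) \<open>0 \<le> a\<close> \<open>0 \<le> c\<close> by auto
    then have "\<mu> (Suc k) + c * \<nu> k \<le> (1 + c) * (\<mu> (Suc k) + \<nu> k)"
      and "\<mu> (Suc k) + a * (c * \<nu> k) + \<nu> k \<le> (2 + a * c) * (\<mu> (Suc k) + \<nu> k)"
      using \<open>0 \<le> c\<close> mult_nonneg_nonneg[of c "\<mu> (Suc k)"] mult_nonneg_nonneg[of "a * c" "\<mu> (Suc k)"]
      by (simp_all add: algebra_simps)
    then have "sqrt \<sigma> * \<alpha> * (\<mu> (Suc k) + c * \<nu> k) + sqrt \<rho> * \<alpha> * (\<mu> (Suc k) + a * (c * \<nu> k) + \<nu> k)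
        \<le> sqrt \<sigma> * \<alpha> * ((1 + c) * (\<mu> (Suc k) + \<nu> k))
          + sqrt \<rho> * \<alpha> * ((2 + a * c) * (\<mu> (Suc k) + \<nu> k))"
      using alpha sigma rho by (intro add_mono mult_left_mono) auto
    also have "\<dots> = K * (\<mu> (Suc k) + \<nu> k)" unfolding K_def by (simp add: algebra_simps)
    finally show "norm (S (Suc (Suc k)) - T_admm (S (Suc k))) \<le> K * (\<mu> (Suc k) + \<nu> k)"
      using approx_admm_state_step_error[OF adm, of k] unfolding S_def a_def c_def by linarith
  qed
qed

lemma approx_admm_state_increment_tendsto:
  assumes adm: "approx_admm P q A C \<rho> \<sigma> \<alpha> \<mu> \<nu> x z y xt zt"
    and "\<forall>k. 0 \<le> \<mu> k" "summable \<mu>" "\<forall>k. 0 \<le> \<nu> k" "summable \<nu>"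
  shows "(\<lambda>k. admm_state (x (Suc k)) (z (Suc k)) (y (Suc k)) - admm_state (x k) (z k) (y k))
           \<longlonglongrightarrow> - T.asymptotic_displacement"
proof -
  define S where "S k = admm_state (x k) (z k) (y k)" for k
  obtain K where "K \<ge> 0" and K: "\<And>k. norm (S (Suc (Suc k)) - T_admm (S (Suc k))) \<le> K * (\<mu> (Suc k) + \<nu> k)"
    using approx_admm_state_error[OF adm assms(2,4)] unfolding S_def by blast
  define e where "e k = S (Suc (Suc k)) - T_admm (S (Suc k))" for k
  have "summable (\<lambda>k. K * (\<mu> (Suc k) + \<nu> k))"
    using assms(3,5) by (intro summable_mult summable_add) (simp_all add: summable_Suc_iff)
  then have "summable (\<lambda>k. norm (e k))"
    by (rule summable_comparison_test[rotated]) (use K in \<open>simp add: e_def\<close>)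
  then have "(\<lambda>k. S (Suc (Suc k)) - S (Suc k)) \<longlonglongrightarrow> - T.asymptotic_displacement"
    by (intro T.perturbed_orbit_increment_tendsto[of "\<lambda>k. S (Suc k)" e]) (simp add: e_def)
  then show ?thesis unfolding S_def by (rule LIMSEQ_imp_Suc)
qed

lemma approx_admm_z_eq:
  assumes adm: "approx_admm P q A C \<rho> \<sigma> \<alpha> \<mu> \<nu> x z y xt zt"
  defines "V \<equiv> \<lambda>k. z k + (1 / \<rho>) *\<^sub>R y k"
  shows "z k = A *v x k + (1 / \<alpha>) *\<^sub>R (A *v (x (Suc k) - x k) - (V (Suc k) - V k))
                 + (zt (Suc k) - A *v xt (Suc k))"
proof -
  have xt: "xt (Suc k) = x k + (1 / \<alpha>) *\<^sub>R (x (Suc k) - x k)"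
    unfolding approx_admm_stepD(2)[OF adm] using alpha by (simp add: vec_eq_iff field_simps)
  have zt: "zt (Suc k) = z k + (1 / \<alpha>) *\<^sub>R (V (Suc k) - V k)"
    unfolding V_def approx_admm_stepD(3)[OF adm] using alpha by (simp add: vec_eq_iff field_simps)
  show ?thesis unfolding xt zt by (simp add: algebra_simps matrix_vector_mult_scaleR)
qed

lemma approx_admm_residual_tendsto:
  assumes adm: "approx_admm P q A C \<rho> \<sigma> \<alpha> \<mu> \<nu> x z y xt zt" and "summable \<mu>"
  shows "(\<lambda>k. zt (Suc k) - A *v xt (Suc k)) \<longlonglongrightarrow> 0"
proof (rule Lim_null_comparison)
  show "\<forall>\<^sub>F k in sequentially. norm (zt (Suc k) - A *v xt (Suc k)) \<le> (1 + onorm ((*v) A)) * \<mu> k"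
  proof (intro always_eventually allI)
    fix k
    obtain \<xi> where xt: "norm (xt (Suc k) - \<xi>) \<le> \<mu> k" and zt: "norm (zt (Suc k) - A *v \<xi>) \<le> \<mu> k"
      using approx_admm_stepD(1)[OF adm, of k] by blast
    have "norm (A *v (\<xi> - xt (Suc k))) \<le> onorm ((*v) A) * \<mu> k"
      using norm_matrix_vector_mult_le[of A "\<xi> - xt (Suc k)"] xt onorm_matrix_vector_mult_nonneg[of A]
      by (metis norm_minus_commute mult_left_mono order_trans)
    moreover have "zt (Suc k) - A *v xt (Suc k) = (zt (Suc k) - A *v \<xi>) + A *v (\<xi> - xt (Suc k))"
      by (simp add: algebra_simps)
    then have "norm (zt (Suc k) - A *v xt (Suc k))
        \<le> norm (zt (Suc k) - A *v \<xi>) + norm (A *v (\<xi> - xt (Suc k)))"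
      by (simp only: norm_triangle_ineq)
    ultimately show "norm (zt (Suc k) - A *v xt (Suc k)) \<le> (1 + onorm ((*v) A)) * \<mu> k"
      using zt by (simp add: algebra_simps)
  qed
  show "(\<lambda>k. (1 + onorm ((*v) A)) * \<mu> k) \<longlonglongrightarrow> 0"
    using summable_LIMSEQ_zero[OF assms(2)] tendsto_mult_right_zero by blast
qed

definition x_increment_limit :: "real^'n" where
  "x_increment_limit = - (1 / sqrt \<sigma>) *\<^sub>R fst T.asymptotic_displacement"

definition y_increment_limit :: "real^'m" where
  "y_increment_limit =
     \<rho> *\<^sub>R (- (1 / sqrt \<rho>) *\<^sub>R snd T.asymptotic_displacement - A *v x_increment_limit)"

lemma approx_admm_increments_tendsto:
  assumes adm: "approx_admm P q A C \<rho> \<sigma> \<alpha> \<mu> \<nu> x z y xt zt"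
    and "\<forall>k. 0 \<le> \<mu> k" "summable \<mu>" "\<forall>k. 0 \<le> \<nu> k" "summable \<nu>"
  shows "(\<lambda>k. x (Suc k) - x k) \<longlonglongrightarrow> x_increment_limit"
    and "(\<lambda>k. y (Suc k) - y k) \<longlonglongrightarrow> y_increment_limit"
proof -
  define X where "X k = x (Suc k) - x k" for k
  define V where "V k = z k + (1 / \<rho>) *\<^sub>R y k" for k
  define W where "W k = V (Suc k) - V k" for k
  define v where "v = - (1 / sqrt \<rho>) *\<^sub>R snd T.asymptotic_displacement"
  let ?dS = "\<lambda>k. admm_state (x (Suc k)) (z (Suc k)) (y (Suc k)) - admm_state (x k) (z k) (y k)"
  have dS: "?dS \<longlonglongrightarrow> - T.asymptotic_displacement"
    by (rule approx_admm_state_increment_tendsto[OF assms])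
  have "(\<lambda>k. (1 / sqrt \<sigma>) *\<^sub>R fst (?dS k)) \<longlonglongrightarrow> (1 / sqrt \<sigma>) *\<^sub>R fst (- T.asymptotic_displacement)"
    by (intro tendsto_scaleR tendsto_const tendsto_fst dS)
  moreover have "(\<lambda>k. (1 / sqrt \<sigma>) *\<^sub>R fst (?dS k)) = X"
    unfolding X_def admm_state_def using sigma by (auto simp: algebra_simps)
  ultimately show X: "X \<longlonglongrightarrow> x_increment_limit" by (simp add: x_increment_limit_def)
  have "(\<lambda>k. (1 / sqrt \<rho>) *\<^sub>R snd (?dS k)) \<longlonglongrightarrow> (1 / sqrt \<rho>) *\<^sub>R snd (- T.asymptotic_displacement)"
    by (intro tendsto_scaleR tendsto_const tendsto_snd dS)
  moreover have "(\<lambda>k. (1 / sqrt \<rho>) *\<^sub>R snd (?dS k)) = W"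
    unfolding W_def V_def admm_state_def using rho by (auto simp: algebra_simps)
  ultimately have W: "W \<longlonglongrightarrow> v" by (simp add: v_def)
  define r where "r k = zt (Suc k) - A *v xt (Suc k)" for k
  have r: "r \<longlonglongrightarrow> 0"
    unfolding r_def by (rule approx_admm_residual_tendsto[OF adm assms(3)])
  have z: "z k = A *v x k + (1 / \<alpha>) *\<^sub>R (A *v X k - W k) + r k" for k
    using approx_admm_z_eq[OF adm, of k] unfolding X_def W_def V_def r_def .
  have "z (Suc k) - z k = A *v X k + (1 / \<alpha>) *\<^sub>R ((A *v X (Suc k) - W (Suc k)) - (A *v X k - W k))
      + (r (Suc k) - r k)" for k
    unfolding z[of "Suc k"] z[of k] X_def by (simp add: algebra_simps)
  moreover have "(\<lambda>k. A *v X k + (1 / \<alpha>) *\<^sub>R ((A *v X (Suc k) - W (Suc k)) - (A *v X k - W k))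
      + (r (Suc k) - r k)) \<longlonglongrightarrow>
      A *v x_increment_limit + (1 / \<alpha>) *\<^sub>R ((A *v x_increment_limit - v) - (A *v x_increment_limit - v)) + (0 - 0)"
    by (intro tendsto_add tendsto_diff tendsto_scaleR tendsto_const LIMSEQ_Suc X W r
        bounded_linear.tendsto[OF matrix_vector_mul_bounded_linear])
  ultimately have Z: "(\<lambda>k. z (Suc k) - z k) \<longlonglongrightarrow> A *v x_increment_limit" by simp
  have "y (Suc k) - y k = \<rho> *\<^sub>R (W k - (z (Suc k) - z k))" for k
    unfolding W_def V_def using rho by (simp add: algebra_simps)
  moreover have "(\<lambda>k. \<rho> *\<^sub>R (W k - (z (Suc k) - z k))) \<longlonglongrightarrow> \<rho> *\<^sub>R (v - A *v x_increment_limit)"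
    by (intro tendsto_scaleR tendsto_const tendsto_diff W Z)
  ultimately show "(\<lambda>k. y (Suc k) - y k) \<longlonglongrightarrow> y_increment_limit"
    by (simp add: y_increment_limit_def v_def)
qed

end

text \<open>The limits depend on \<open>T_admm\<close> only, so neither the common initial values nor the symmetry
  of \<open>P\<close> is needed, and of the structure of \<open>C\<close> only closedness and convexity are used.\<close>
theorem proposition1:
  fixes P :: "real^'n^'n" and q :: "real^'n" and A :: "real^'n^'m"
    and C :: "(real^'m) set"
    and \<rho> \<sigma> \<alpha> :: real and x0 :: "real^'n" and z0 y0 :: "real^'m"
    and \<mu> \<nu> :: "nat \<Rightarrow> real"
    and x xe xt xte :: "nat \<Rightarrow> real^'n" and z y ze ye zt zte :: "nat \<Rightarrow> real^'m"
  assumes P_sym: "transpose P = P"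
    and P_psd: "\<forall>v. 0 \<le> v \<bullet> (P *v v)"
    and C_struct: "product_compact_cone C"
    and rho: "\<rho> > 0" and sigma: "\<sigma> > 0" and alpha: "0 < \<alpha>" "\<alpha> < 2"
    and mu_nonneg: "\<forall>k. 0 \<le> \<mu> k" and mu_sum: "summable \<mu>"
    and nu_nonneg: "\<forall>k. 0 \<le> \<nu> k" and nu_sum: "summable \<nu>"
    and approx: "approx_admm P q A C \<rho> \<sigma> \<alpha> \<mu> \<nu> x z y xt zt"
    and approx_init: "x 0 = x0" "z 0 = z0" "y 0 = y0"
    and exact: "approx_admm P q A C \<rho> \<sigma> \<alpha> (\<lambda>_. 0) (\<lambda>_. 0) xe ze ye xte zte"
    and exact_init: "xe 0 = x0" "ze 0 = z0" "ye 0 = y0"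
  shows "\<exists>\<delta>x \<delta>y.
           (\<lambda>k. x (Suc k) - x k) \<longlonglongrightarrow> \<delta>x \<and> (\<lambda>k. y (Suc k) - y k) \<longlonglongrightarrow> \<delta>y \<and>
           (\<lambda>k. xe (Suc k) - xe k) \<longlonglongrightarrow> \<delta>x \<and> (\<lambda>k. ye (Suc k) - ye k) \<longlonglongrightarrow> \<delta>y"
proof -
  interpret admm P q A C \<rho> \<sigma> \<alpha>
    using P_psd rho sigma alpha product_compact_cone_closed_convex_nonempty[OF C_struct]
    by unfold_locales auto
  show ?thesis
    using approx_admm_increments_tendsto[OF approx mu_nonneg mu_sum nu_nonneg nu_sum]
      approx_admm_increments_tendsto[OF exact] by auto
qed

end
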